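(* Let $U, V, W$ be vector spaces over a field $F$, let $T_1 \colon V \to W$ and $T_2 \colon U \to V$ be linear with outer inverses $G_1 = \operatorname{O}(T_1, \mathscr{B}_1, E_1)$ and $G_2 = \operatorname{O}(T_2, \mathscr{B}_2, E_2)$, where $\mathscr{B}_1\leq V^*$ and $\mathscr{B}_2\leq U^*$ are orthogonally closed subspaces, $E_1\leq W$ and $E_2\leq V$. Let $\mathscr{C}_2 = T_2(\mathscr{B}_2^{\perp})^{\perp}$ and $K_1 = T_1^{-1}(E_1)$. The following conditions are equivalent: (i) $G_2G_1$ is an outer inverse of $T_1T_2$. (ii) $\mathscr{C}_2 + (\mathscr{B}_1 \cap E_2^{\perp}) \geq \mathscr{B}_1 \cap (E_2 \cap K_1)^{\perp}$. (iii) $\mathscr{B}_1 \geq \mathscr{C}_2 \cap (E_2 \cap \mathscr{B}_1^{\perp})^{\perp} \cap (E_2 \cap K_1)^{\perp}$. (iv) $K_1 \oplus (E_2 \cap \mathscr{B}_1^{\perp}) \geq E_2 \cap (\mathscr{B}_1 \cap \mathscr{C}_2)^{\perp}$. (v) $E_2 \geq K_1 \cap (\mathscr{B}_1 \cap E_2^{\perp})^{\perp} \cap (\mathscr{B}_1 \cap \mathscr{C}_2)^{\perp}$.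
   Context: Vector spaces are arbitrary (possibly infinite-dimensional); $V^*$ is the algebraic dual of $V$. For $V_1\leq V$, $V_1^{\perp}=\{\beta\in V^* \mid \beta(v)=0 \text{ for all } v\in V_1\}\leq V^*$; for $\mathscr{B}\leq V^*$, $\mathscr{B}^{\perp}=\{v\in V\mid \beta(v)=0\text{ for all }\beta\in\mathscr{B}\}\leq V$. A subspace $\mathscr{B}\leq V^*$ is orthogonally closed if $\mathscr{B}=\mathscr{B}^{\perp\perp}$. For a linear map $T\colon V\to W$, a linear map $G\colon W\to V$ is an outer inverse of $T$ if $GTG=G$; an outer inverse of $T$ is uniquely determined by its image and kernel. For an orthogonally closed $\mathscr{B}\leq V^*$ and $E\leq W$, $\operatorname{O}(T,\mathscr{B},E)$ denotes the outer inverse $G$ of $T$ with $\operatorname{Im} G=\mathscr{B}^{\perp}$ and $\operatorname{Ker} G=E$. $T_1^{-1}(E_1)$ denotes the inverse image. For subspaces, $\leq$ (and $\geq$) denotes inclusion, and $\oplus$ denotes a sum of subspaces that is direct. *)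

theory Defs
  imports Complex_Main "HOL-Library.Function_Algebras" "HOL-Library.Set_Algebras"
begin

text \<open>
  Vector spaces are types with an explicit scalar multiplication, as in
  \<^theory>\<open>HOL.Vector_Spaces\<close>; the algebraic dual is a set of functions into the field,
  itself living inside the vector space of all such functions with pointwise operations.
\<close>

definition dual_space :: "('f::field \<Rightarrow> 'v::ab_group_add \<Rightarrow> 'v) \<Rightarrow> ('v \<Rightarrow> 'f) set"
  where "dual_space s = {\<beta>. Vector_Spaces.linear s (*) \<beta>}"

definition fun_scale :: "'f::field \<Rightarrow> ('v \<Rightarrow> 'f) \<Rightarrow> ('v \<Rightarrow> 'f)"
  where "fun_scale c \<beta> = (\<lambda>v. c * \<beta> v)"

lemma vector_space_fun_scale: "vector_space fun_scale"
  by unfold_locales (auto simp: fun_scale_def fun_eq_iff algebra_simps)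

definition dual_subspace :: "('f::field \<Rightarrow> 'v::ab_group_add \<Rightarrow> 'v) \<Rightarrow> ('v \<Rightarrow> 'f) set \<Rightarrow> bool"
  where "dual_subspace s B \<longleftrightarrow> B \<subseteq> dual_space s \<and> module.subspace fun_scale B"

definition perp :: "('f::field \<Rightarrow> 'v::ab_group_add \<Rightarrow> 'v) \<Rightarrow> 'v set \<Rightarrow> ('v \<Rightarrow> 'f) set"
  where "perp s S = {\<beta> \<in> dual_space s. \<forall>v\<in>S. \<beta> v = 0}"

definition coperp :: "('v \<Rightarrow> 'f::zero) set \<Rightarrow> 'v set"
  where "coperp B = {v. \<forall>\<beta>\<in>B. \<beta> v = 0}"

definition orthogonally_closed ::
    "('f::field \<Rightarrow> 'v::ab_group_add \<Rightarrow> 'v) \<Rightarrow> ('v \<Rightarrow> 'f) set \<Rightarrow> bool"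
  where "orthogonally_closed s B \<longleftrightarrow> B = perp s (coperp B)"

definition outer_inverse ::
    "('f::field \<Rightarrow> 'v::ab_group_add \<Rightarrow> 'v) \<Rightarrow> ('f \<Rightarrow> 'w::ab_group_add \<Rightarrow> 'w) \<Rightarrow>
     ('v \<Rightarrow> 'w) \<Rightarrow> ('w \<Rightarrow> 'v) \<Rightarrow> bool"
  where "outer_inverse sV sW T G \<longleftrightarrow> Vector_Spaces.linear sW sV G \<and> G \<circ> T \<circ> G = G"

text \<open>
  The relation \<open>G = O(T, B, E)\<close>. It is stated as a predicate on \<open>G\<close> because an outer
  inverse with prescribed image and kernel need not exist; it is unique when it does
  (\<open>is_outer_inverse_O_unique\<close>).
\<close>

definition is_outer_inverse_O ::
    "('f::field \<Rightarrow> 'v::ab_group_add \<Rightarrow> 'v) \<Rightarrow> ('f \<Rightarrow> 'w::ab_group_add \<Rightarrow> 'w) \<Rightarrow>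
     ('v \<Rightarrow> 'w) \<Rightarrow> ('v \<Rightarrow> 'f) set \<Rightarrow> 'w set \<Rightarrow> ('w \<Rightarrow> 'v) \<Rightarrow> bool"
  where "is_outer_inverse_O sV sW T B E G \<longleftrightarrow>
    outer_inverse sV sW T G \<and> range G = coperp B \<and> {w. G w = 0} = E"

lemma is_outer_inverse_O_unique:
  assumes "is_outer_inverse_O sV sW T B E G" and "is_outer_inverse_O sV sW T B E H"
  shows "G = H"
proof
  fix w
  have linG: "Vector_Spaces.linear sW sV G" and linH: "Vector_Spaces.linear sW sV H"
    and G: "\<And>x. G (T (G x)) = G x" and H: "\<And>x. H (T (H x)) = H x"
    and rng: "range G = range H" and ker: "{x. G x = 0} = {x. H x = 0}"
    using assms by (auto simp: is_outer_inverse_O_def outer_inverse_def fun_eq_iff)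
  interpret G: Vector_Spaces.linear sW sV G by (fact linG)
  interpret H: Vector_Spaces.linear sW sV H by (fact linH)
  have "G (T (G w) - w) = 0" by (simp add: G.diff G)
  then have "H (T (G w) - w) = 0" using ker by blast
  then have "H (T (G w)) = H w" by (simp add: H.diff)
  moreover obtain u where "G w = H u" using rng by (metis rangeE rangeI)
  ultimately show "G w = H w" using H by metis
qed

end

theory Submission imports Defs
begin

text \<open>
  The maps \<open>P = G1 T1\<close> and \<open>Q = T2 G2\<close> are projections of \<open>V\<close>, with images \<open>coperp B1\<close> and
  \<open>J = T2 (coperp B2)\<close> and kernels \<open>K1\<close> and \<open>E2\<close>; since \<open>T2\<close> is injective on the image of \<open>G2\<close>,
  condition (i) says that \<open>Q P\<close> is idempotent. Writing \<open>I\<close> for the image of \<open>P\<close>, this means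
  that \<open>P\<close> maps \<open>E2 \<inter> (I + J)\<close> into \<open>E2\<close>. Because every subspace of \<open>V\<close> is the common kernel of the
  functionals vanishing on it, each of (ii)--(v) becomes an inclusion between sums and
  intersections of \<open>I\<close>, \<open>J\<close>, \<open>K1\<close>, \<open>E2\<close>, which is then compared with the last condition by
  splitting vectors along \<open>V = I \<oplus> K1\<close> and \<open>V = J \<oplus> E2\<close>.
\<close>

section \<open>Subspaces and their annihilators\<close>

lemma perp_antimono: "A \<subseteq> B \<Longrightarrow> perp s B \<subseteq> perp s A"
  by (auto simp: perp_def)

lemma coperp_antimono: "A \<subseteq> B \<Longrightarrow> coperp B \<subseteq> coperp A"
  by (auto simp: coperp_def)

context vector_space
begin

lemma dual_spaceD:
  assumes "\<beta> \<in> dual_space scale"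
  shows "\<beta> (x + y) = \<beta> x + \<beta> y" "\<beta> (x - y) = \<beta> x - \<beta> y" "\<beta> 0 = 0"
proof -
  interpret b: Vector_Spaces.linear scale "(*)" \<beta>
    using assms by (simp add: dual_space_def)
  show "\<beta> (x + y) = \<beta> x + \<beta> y" "\<beta> (x - y) = \<beta> x - \<beta> y" "\<beta> 0 = 0"
    by (rule b.add b.diff b.zero)+
qed

text \<open>Adding \<open>v\<close> to a basis of \<open>A\<close> keeps it independent, so the
  values 1 at \<open>v\<close> and 0 on that basis extend to a functional on the whole
  space.\<close>

lemma exists_separating_functional:
  assumes A: "subspace A" and v: "v \<notin> A"
  shows "\<exists>\<beta>\<in>perp scale A. \<beta> v = 1"
proof -
  interpret fp: vector_space_pair scale "(*) :: 'a \<Rightarrow> 'a \<Rightarrow> 'a"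
    by unfold_locales (auto simp: algebra_simps)
  obtain B where B: "independent B" "span B = A"
    using basis_exists[of A] A by (metis span_subspace)
  have "independent (insert v B)"
    using B v by (simp add: independent_insert)
  then obtain \<beta> where \<beta>: "Vector_Spaces.linear scale (*) \<beta>"
      "\<forall>x\<in>insert v B. \<beta> x = (if x = v then 1 else 0)"
    using fp.linear_independent_extend[of "insert v B" "\<lambda>x. if x = v then 1 else 0"] by blast
  have "\<beta> x = 0" if "x \<in> B" for x
    using that \<beta>(2) v B(2) span_base by auto
  then have "\<beta> x = 0" if "x \<in> A" for x
    using fp.linear_eq_0_on_span[OF \<beta>(1)] that B(2) by blast
  then show ?thesis
    using \<beta> by (auto simp: perp_def dual_space_def)
qed

text \<open>A vector outside \<open>A\<close> is detected by a separating functional; no bound on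
  the dimension enters.\<close>

lemma coperp_perp:
  assumes "subspace A"
  shows "coperp (perp scale A) = A"
proof
  show "A \<subseteq> coperp (perp scale A)"
    by (auto simp: perp_def coperp_def)
  show "coperp (perp scale A) \<subseteq> A"
    using exists_separating_functional[OF assms] by (fastforce simp: coperp_def)
qed

lemma perp_subset_perp_iff:
  assumes "subspace A" "subspace B"
  shows "perp scale A \<subseteq> perp scale B \<longleftrightarrow> B \<subseteq> A"
  using coperp_antimono[of "perp scale A" "perp scale B"] assms
  by (auto simp: coperp_perp dest: perp_antimono)

lemma perp_plus:
  assumes "0 \<in> A" "0 \<in> B"
  shows "perp scale (A + B) = perp scale A \<inter> perp scale B"
proof
  have "A \<subseteq> A + B" "B \<subseteq> A + B"
    using assms by (metis add.right_neutral set_plus_intro subsetI,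
      metis add.left_neutral set_plus_intro subsetI)
  then show "perp scale (A + B) \<subseteq> perp scale A \<inter> perp scale B"
    by (simp add: perp_antimono)
  show "perp scale A \<inter> perp scale B \<subseteq> perp scale (A + B)"
    by (auto simp: perp_def dual_spaceD elim!: set_plus_elim)
qed

lemma subspace_plus:
  assumes "subspace A" "subspace B"
  shows "subspace (A + B)"
proof -
  have "A + B = {x + y |x y. x \<in> A \<and> y \<in> B}"
    by (auto simp: set_plus_def)
  then show ?thesis
    using subspace_sums[OF assms] by simp
qed

end

section \<open>Pairs of projections\<close>

locale projection_pair = vector_space scale
  for scale :: "'a::field \<Rightarrow> 'b::ab_group_add \<Rightarrow> 'b" +
  fixes P Q :: "'b \<Rightarrow> 'b"
  assumes linear_P: "Vector_Spaces.linear scale scale P"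
    and linear_Q: "Vector_Spaces.linear scale scale Q"
    and P_idem [simp]: "P (P x) = P x"
    and Q_idem [simp]: "Q (Q x) = Q x"
begin

sublocale P: Vector_Spaces.linear scale scale P by (rule linear_P)
sublocale Q: Vector_Spaces.linear scale scale Q by (rule linear_Q)

abbreviation "I \<equiv> range P"
abbreviation "J \<equiv> range Q"
abbreviation "K \<equiv> {v. P v = 0}"
abbreviation "E \<equiv> {v. Q v = 0}"

lemma mem_I: "x \<in> I \<longleftrightarrow> P x = x"
  by (metis P_idem rangeE rangeI)

lemma mem_J: "x \<in> J \<longleftrightarrow> Q x = x"
  by (metis Q_idem rangeE rangeI)

lemma subspaces [simp]: "subspace I" "subspace J" "subspace K" "subspace E"
  by (auto intro: P.subspace_image Q.subspace_image P.subspace_kernel Q.subspace_kernel)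

text \<open>The intersection is \<open>perp scale (A + B)\<close>, and \<open>coperp\<close> undoes
  \<open>perp\<close>. This turns the annihilators in (iv) and (v) into sums.\<close>

lemma coperp_perp_Int:
  assumes "subspace A" "subspace B"
  shows "coperp (perp scale A \<inter> perp scale B) = A + B"
  using assms by (metis coperp_perp perp_plus subspace_0 subspace_plus)

text \<open>The common form to which all five conditions are reduced. If
  \<open>Q (i + j) = 0\<close> then \<open>j = - Q i\<close>, so \<open>E \<inter> (I + J)\<close>
  is the set of all \<open>P x - Q (P x)\<close>; the condition says that \<open>Q \<circ> P\<close>
  kills these.\<close>

definition P_preserves :: bool
  where "P_preserves \<longleftrightarrow> (\<forall>y \<in> E \<inter> (I + J). P y \<in> E)"

lemma P_preservesI:
  "(\<And>i j. P i = i \<Longrightarrow> Q j = j \<Longrightarrow> Q (i + j) = 0 \<Longrightarrow> Q (P (i + j)) = 0) \<Longrightarrow> P_preserves"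
  unfolding P_preserves_def by (auto simp: mem_I mem_J elim!: set_plus_elim)

lemma P_preservesD:
  "P_preserves \<Longrightarrow> P i = i \<Longrightarrow> Q j = j \<Longrightarrow> Q (i + j) = 0 \<Longrightarrow> Q (P (i + j)) = 0"
  unfolding P_preserves_def using set_plus_intro[of i I j J] by (auto simp: mem_I mem_J)

lemma idempotent_iff: "(\<forall>x. Q (P (Q (P x))) = Q (P x)) \<longleftrightarrow> P_preserves"
proof
  assume idem: "\<forall>x. Q (P (Q (P x))) = Q (P x)"
  show P_preserves
  proof (rule P_preservesI)
    fix i j assume *: "P i = i" "Q j = j" "Q (i + j) = 0"
    then have "j = - Q i" by (simp add: Q.add eq_neg_iff_add_eq_0 add.commute)
    then show "Q (P (i + j)) = 0"
      using idem[rule_format, of i] * by (simp add: P.diff Q.diff)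
  qed
next
  assume P_preserves
  then have "Q (P (P x + - Q (P x))) = 0" for x
    by (rule P_preservesD) (simp_all add: Q.diff Q.neg)
  then show "\<forall>x. Q (P (Q (P x))) = Q (P x)"
    by (simp add: P.diff Q.diff)
qed

text \<open>Condition (iv). Split \<open>y\<close> as \<open>(y - P y) + P y\<close> along
  \<open>K\<close> and \<open>I\<close>; conversely \<open>P\<close> reads off the component in
  \<open>E \<inter> I\<close>.\<close>

lemma P_preserves_iff_E_subset:
  "P_preserves \<longleftrightarrow> E \<inter> (I + J) \<subseteq> K + (E \<inter> I)"
proof
  assume pres: P_preserves
  show "E \<inter> (I + J) \<subseteq> K + (E \<inter> I)"
  proof
    fix y assume "y \<in> E \<inter> (I + J)"
    then have "P y \<in> E \<inter> I" using pres by (auto simp: P_preserves_def)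
    moreover have "y - P y \<in> K" by (simp add: P.diff)
    ultimately show "y \<in> K + (E \<inter> I)" by (metis diff_add_cancel set_plus_intro)
  qed
next
  assume sub: "E \<inter> (I + J) \<subseteq> K + (E \<inter> I)"
  show P_preserves unfolding P_preserves_def
  proof
    fix y assume "y \<in> E \<inter> (I + J)"
    with sub have "y \<in> K + (E \<inter> I)" by (rule subsetD)
    then obtain k e where "y = k + e" "k \<in> K" "e \<in> E \<inter> I"
      by (rule set_plus_elim)
    then show "P y \<in> E" by (simp add: mem_I P.add)
  qed
qed

text \<open>Condition (v). For \<open>y = i + e\<close> in \<open>K\<close>, applying
  \<open>P\<close> gives \<open>i = - P e\<close>, hence \<open>Q y = - Q (P e)\<close>. In the
  converse the vector to test is \<open>y - P y\<close> with \<open>y\<close> in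
  \<open>E \<inter> (I + J)\<close>.\<close>

lemma P_preserves_iff_K_subset:
  "P_preserves \<longleftrightarrow> K \<inter> (I + E) \<inter> (I + J) \<subseteq> E"
proof
  assume pres: P_preserves
  show "K \<inter> (I + E) \<inter> (I + J) \<subseteq> E"
  proof
    fix y assume y: "y \<in> K \<inter> (I + E) \<inter> (I + J)"
    then have "y \<in> I + E" "y \<in> I + J" "P y = 0" by simp_all
    from \<open>y \<in> I + E\<close> obtain i e where ie: "y = i + e" "P i = i" "Q e = 0"
      by (auto elim!: set_plus_elim)
    from \<open>y \<in> I + J\<close> obtain i' j where ij: "y = i' + j" "P i' = i'" "Q j = j"
      by (auto elim!: set_plus_elim)
    \<comment> \<open>Comparing the two decompositions of \<open>y\<close> puts \<open>e\<close> in
      \<open>E \<inter> (I + J)\<close>, where the hypothesis applies.\<close>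
    have e: "e = (i' - i) + j" using ie(1) ij(1) by (simp add: algebra_simps)
    have "Q (P e) = 0"
      unfolding e by (rule P_preservesD[OF pres])
        (use ie ij e in \<open>simp_all add: P.diff\<close>)
    moreover have "i + P e = 0" using \<open>P y = 0\<close> ie by (simp add: P.add)
    ultimately show "y \<in> E"
      using Q.add[of i "P e"] ie by (simp add: Q.add)
  qed
next
  assume sub: "K \<inter> (I + E) \<inter> (I + J) \<subseteq> E"
  show P_preserves
  proof (rule P_preservesI)
    fix i j assume *: "P i = i" "Q j = j" "Q (i + j) = 0"
    define y where "y = i + j"
    have "y - P y \<in> K" by (simp add: P.diff)
    moreover have "- P y + y \<in> I + E"
      by (rule set_plus_intro) (use * in \<open>simp_all add: mem_I P.neg y_def\<close>)
    moreover have "(i - P y) + j \<in> I + J"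
      by (rule set_plus_intro) (use * in \<open>simp_all add: mem_I mem_J P.diff\<close>)
    ultimately have "y - P y \<in> E"
      using sub by (auto simp: y_def algebra_simps)
    then show "Q (P (i + j)) = 0"
      using * by (simp add: Q.diff y_def)
  qed
qed

text \<open>Condition (iii) before dualizing. With \<open>y = x - Q x\<close>, the required
  decomposition is \<open>x = Q x + P y + (y - P y)\<close>.\<close>

lemma P_preserves_iff_I_subset:
  "P_preserves \<longleftrightarrow> I \<subseteq> J + (E \<inter> I) + (E \<inter> K)"
proof
  assume pres: P_preserves
  show "I \<subseteq> J + (E \<inter> I) + (E \<inter> K)"
  proof
    fix x assume x: "x \<in> I"
    define y where "y = x + - Q x"
    have "Q (P y) = 0"
      unfolding y_def by (rule P_preservesD[OF pres])
        (use x in \<open>simp_all add: mem_I Q.diff Q.neg\<close>)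
    moreover have "Q y = 0" by (simp add: y_def Q.diff)
    ultimately have "P y \<in> E \<inter> I" "y - P y \<in> E \<inter> K"
      by (simp_all add: Q.diff P.diff)
    then have "Q x + P y + (y - P y) \<in> J + (E \<inter> I) + (E \<inter> K)"
      by (intro set_plus_intro) auto
    then show "x \<in> J + (E \<inter> I) + (E \<inter> K)" by (simp add: y_def)
  qed
next
  assume sub: "I \<subseteq> J + (E \<inter> I) + (E \<inter> K)"
  show P_preserves
  proof (rule P_preservesI)
    fix i j assume *: "P i = i" "Q j = j" "Q (i + j) = 0"
    then have "i \<in> J + (E \<inter> I) + (E \<inter> K)" using sub by (auto simp: mem_I)
    then obtain j' e k where i: "i = j' + e + k" and
        "Q j' = j'" "Q e = 0" "P e = e" "Q k = 0" "P k = 0"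
      by (auto simp: mem_I mem_J elim!: set_plus_elim)
    \<comment> \<open>Apply \<open>Q\<close> to \<open>i + j\<close>: the components
      \<open>e\<close> and \<open>k\<close> lie in \<open>E\<close>, while \<open>j'\<close> and
      \<open>j\<close> are fixed.\<close>
    moreover have "j' + j = 0" using calculation * by (simp add: Q.add)
    then have "i + j = e + k" using i by (simp add: algebra_simps)
    moreover from this have "P (i + j) = e" using calculation by (simp only: P.add) simp
    ultimately show "Q (P (i + j)) = 0" by simp
  qed
qed

text \<open>Condition (ii), where the sum lives in the dual. The splitting is
  \<open>\<beta> = (\<beta> - \<beta> \<circ> Q) + \<beta> \<circ> Q\<close>: the first term kills
  \<open>J\<close>, the second kills \<open>E\<close>, and only vanishing of the second on
  \<open>I\<close> needs the hypothesis.\<close>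

lemma P_preserves_iff_perp_subset:
  "P_preserves \<longleftrightarrow>
    perp scale I \<inter> perp scale (E \<inter> K) \<subseteq> perp scale J + (perp scale I \<inter> perp scale E)"
proof
  assume pres: P_preserves
  show "perp scale I \<inter> perp scale (E \<inter> K) \<subseteq> perp scale J + (perp scale I \<inter> perp scale E)"
  proof
    fix \<beta> assume \<beta>: "\<beta> \<in> perp scale I \<inter> perp scale (E \<inter> K)"
    then have dual: "\<beta> \<in> dual_space scale"
      and \<beta>I: "\<And>x. \<beta> (P x) = 0"
      and \<beta>EK: "\<And>x. Q x = 0 \<Longrightarrow> P x = 0 \<Longrightarrow> \<beta> x = 0"
      by (auto simp: perp_def)
    have lin: "Vector_Spaces.linear scale (*) \<beta>"
      using dual by (simp add: dual_space_def)
    interpret fp: vector_space_pair scale "(*) :: 'a \<Rightarrow> 'a \<Rightarrow> 'a"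
      by unfold_locales (auto simp: algebra_simps)
    have linQ: "Vector_Spaces.linear scale (*) (\<beta> \<circ> Q)"
      by (rule Vector_Spaces.linear_compose[OF linear_Q lin])
    have linR: "Vector_Spaces.linear scale (*) (\<lambda>x. \<beta> x - (\<beta> \<circ> Q) x)"
      by (rule fp.linear_compose_sub[OF lin linQ])
    have "\<beta> (Q (P x)) = 0" for x
    proof -
      \<comment> \<open>Here \<open>y - P y\<close> lies in \<open>E \<inter> K\<close>, so
        \<open>\<beta>\<close> kills it; as \<open>\<beta>\<close> also kills \<open>I\<close>, it
        kills \<open>y\<close> and then \<open>Q (P x)\<close>.\<close>
      define y where "y = P x + - Q (P x)"
      have "Q (P y) = 0"
        unfolding y_def by (rule P_preservesD[OF pres]) (simp_all add: Q.diff Q.neg)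
      moreover have "Q y = 0" by (simp add: y_def Q.diff)
      ultimately have "\<beta> (y - P y) = 0" by (intro \<beta>EK) (simp_all add: P.diff Q.diff)
      then have "\<beta> y = 0" by (simp add: dual_spaceD[OF dual] \<beta>I)
      then show ?thesis by (simp add: y_def dual_spaceD[OF dual] \<beta>I)
    qed
    then have "\<beta> \<circ> Q \<in> perp scale I \<inter> perp scale E"
      using linQ by (auto simp: perp_def dual_space_def dual_spaceD[OF dual])
    moreover have "(\<lambda>x. \<beta> x - (\<beta> \<circ> Q) x) \<in> perp scale J"
      using linR by (auto simp: perp_def dual_space_def)
    moreover have "\<beta> = (\<lambda>x. \<beta> x - (\<beta> \<circ> Q) x) + (\<beta> \<circ> Q)" by (simp add: fun_eq_iff)
    ultimately show "\<beta> \<in> perp scale J + (perp scale I \<inter> perp scale E)"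
      by (metis set_plus_intro)
  qed
next
  assume sub: "perp scale I \<inter> perp scale (E \<inter> K) \<subseteq> perp scale J + (perp scale I \<inter> perp scale E)"
  show P_preserves
  proof (rule P_preservesI)
    fix i j assume *: "P i = i" "Q j = j" "Q (i + j) = 0"
    \<comment> \<open>Membership of \<open>j\<close> in \<open>I + (E \<inter> K)\<close> is tested
      on functionals: \<open>\<gamma>\<close> kills \<open>j\<close> itself, and
      \<open>\<delta>\<close> kills it because \<open>j = (i + j) - i\<close> with
      \<open>i + j\<close> in \<open>E\<close>.\<close>
    have "\<beta> j = 0" if "\<beta> \<in> perp scale I \<inter> perp scale (E \<inter> K)" for \<beta>
    proof -
      obtain \<gamma> \<delta> where "\<beta> = \<gamma> + \<delta>" and \<gamma>: "\<gamma> \<in> perp scale J"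
          and \<delta>: "\<delta> \<in> perp scale I" "\<delta> \<in> perp scale E"
        using sub \<open>\<beta> \<in> _\<close> by (blast elim: set_plus_elim)
      moreover have "\<gamma> (Q j) = 0" using \<gamma> by (simp add: perp_def)
      then have "\<gamma> j = 0" using *(2) by simp
      moreover have "\<delta> ((i + j) - i) = 0"
      proof -
        have "\<delta> \<in> dual_space scale" "\<delta> (i + j) = 0" "\<delta> (P i) = 0"
          using \<delta> *(3) by (simp_all add: perp_def)
        then show ?thesis using *(1) dual_spaceD(2)[of \<delta> "i + j" i] by simp
      qed
      ultimately show "\<beta> j = 0" by simp
    qed
    then have "j \<in> coperp (perp scale I \<inter> perp scale (E \<inter> K))"
      by (simp add: coperp_def)
    then have "j \<in> I + (E \<inter> K)"
      by (simp add: coperp_perp_Int subspace_inter)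
    then obtain i' k where j: "j = i' + k" "P i' = i'" "Q k = 0" "P k = 0"
      by (auto simp: mem_I elim!: set_plus_elim)
    then have "P (i + j) = (i + j) - k" using *(1) by (simp add: P.add)
    then show "Q (P (i + j)) = 0" using *(3) j(3) by (simp only: Q.diff) simp
  qed
qed

text \<open>Annihilators turn the sum into an intersection and reverse the inclusion, which yields
  (iii) as stated.\<close>

lemma I_subset_iff_perp:
  "I \<subseteq> J + (E \<inter> I) + (E \<inter> K) \<longleftrightarrow>
    perp scale J \<inter> perp scale (E \<inter> I) \<inter> perp scale (E \<inter> K) \<subseteq> perp scale I"
proof -
  have "perp scale J \<inter> perp scale (E \<inter> I) \<inter> perp scale (E \<inter> K)
      = perp scale (J + (E \<inter> I) + (E \<inter> K))"
    using perp_plus[OF subspace_0 subspace_0, of "J + (E \<inter> I)" "E \<inter> K"]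
      perp_plus[OF subspace_0 subspace_0, of J "E \<inter> I"]
    by (simp add: subspace_plus subspace_inter)
  then show ?thesis
    by (simp add: perp_subset_perp_iff subspace_plus subspace_inter)
qed

end

section \<open>From outer inverses to projections\<close>

lemma outer_inverse_comp_iff:
  assumes G1: "outer_inverse sV sW T1 G1" and G2: "outer_inverse sU sV T2 G2"
  shows "outer_inverse sU sW (T1 \<circ> T2) (G2 \<circ> G1) \<longleftrightarrow>
    (\<forall>x. T2 (G2 (G1 (T1 (T2 (G2 (G1 (T1 x))))))) = T2 (G2 (G1 (T1 x))))"
    (is "?L \<longleftrightarrow> ?R")
proof
  assume ?L
  \<comment> \<open>Evaluate the outer inverse identity at \<open>T1 x\<close> and apply
    \<open>T2\<close>.\<close>
  then show ?R by (simp add: outer_inverse_def fun_eq_iff)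
next
  assume R: ?R
  have e: "G1 (T1 (G1 w)) = G1 w" "G2 (T2 (G2 v)) = G2 v" for w v
    using G1 G2 by (simp_all add: outer_inverse_def fun_eq_iff)
  \<comment> \<open>Evaluating at \<open>G1 w\<close> and applying \<open>G2\<close> cancels the
    inner \<open>G1 \<circ> T1\<close> and the outer \<open>G2 \<circ> T2\<close>.\<close>
  have "G2 (G1 (T1 (T2 (G2 (G1 w))))) = G2 (G1 w)" for w
    using arg_cong[OF R[rule_format, of "G1 w"], of G2] by (simp add: e)
  moreover have "Vector_Spaces.linear sW sU (G2 \<circ> G1)"
    using G1 G2 by (auto simp: outer_inverse_def intro: Vector_Spaces.linear_compose)
  ultimately show ?L by (simp add: outer_inverse_def fun_eq_iff)
qed

theorem corollary18:
  fixes sU :: "'f::field \<Rightarrow> 'u::ab_group_add \<Rightarrow> 'u"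
    and sV :: "'f \<Rightarrow> 'v::ab_group_add \<Rightarrow> 'v"
    and sW :: "'f \<Rightarrow> 'w::ab_group_add \<Rightarrow> 'w"
    and T1 :: "'v \<Rightarrow> 'w" and T2 :: "'u \<Rightarrow> 'v"
    and G1 :: "'w \<Rightarrow> 'v" and G2 :: "'v \<Rightarrow> 'u"
    and B1 :: "('v \<Rightarrow> 'f) set" and B2 :: "('u \<Rightarrow> 'f) set"
    and E1 :: "'w set" and E2 :: "'v set"
    and C2 :: "('v \<Rightarrow> 'f) set" and K1 :: "'v set"
  assumes "vector_space sU" and "vector_space sV" and "vector_space sW"
    and "Vector_Spaces.linear sV sW T1" and "Vector_Spaces.linear sU sV T2"
    and "dual_subspace sV B1" and "orthogonally_closed sV B1"
    and "dual_subspace sU B2" and "orthogonally_closed sU B2"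
    and "module.subspace sW E1" and "module.subspace sV E2"
    and "is_outer_inverse_O sV sW T1 B1 E1 G1"
    and "is_outer_inverse_O sU sV T2 B2 E2 G2"
    and C2: "C2 = perp sV (T2 ` coperp B2)"
    and K1: "K1 = T1 -` E1"
  shows
    "(outer_inverse sU sW (T1 \<circ> T2) (G2 \<circ> G1)
        \<longleftrightarrow> B1 \<inter> perp sV (E2 \<inter> K1) \<subseteq> C2 + (B1 \<inter> perp sV E2)) \<and>
     (outer_inverse sU sW (T1 \<circ> T2) (G2 \<circ> G1)
        \<longleftrightarrow> C2 \<inter> perp sV (E2 \<inter> coperp B1) \<inter> perp sV (E2 \<inter> K1) \<subseteq> B1) \<and>
     (outer_inverse sU sW (T1 \<circ> T2) (G2 \<circ> G1)
        \<longleftrightarrow> K1 \<inter> (E2 \<inter> coperp B1) = {0} \<and>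
            E2 \<inter> coperp (B1 \<inter> C2) \<subseteq> K1 + (E2 \<inter> coperp B1)) \<and>
     (outer_inverse sU sW (T1 \<circ> T2) (G2 \<circ> G1)
        \<longleftrightarrow> K1 \<inter> coperp (B1 \<inter> perp sV E2) \<inter> coperp (B1 \<inter> C2) \<subseteq> E2)"
proof -
  define P where "P = G1 \<circ> T1"
  define Q where "Q = T2 \<circ> G2"
  have O1: "outer_inverse sV sW T1 G1" "range G1 = coperp B1" "{w. G1 w = 0} = E1"
    and O2: "outer_inverse sU sV T2 G2" "range G2 = coperp B2" "{v. G2 v = 0} = E2"
    using assms(12,13) by (simp_all add: is_outer_inverse_O_def)
  have e: "G1 (T1 (G1 w)) = G1 w" "G2 (T2 (G2 v)) = G2 v" for w v
    using O1(1) O2(1) by (simp_all add: outer_inverse_def fun_eq_iff)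
  interpret T2: Vector_Spaces.linear sU sV T2 by (rule assms(5))
  interpret G2: Vector_Spaces.linear sV sU G2 using O2(1) by (simp add: outer_inverse_def)
  interpret PQ: projection_pair sV P Q
  proof (intro projection_pair.intro projection_pair_axioms.intro assms(2))
    show "Vector_Spaces.linear sV sV P" "Vector_Spaces.linear sV sV Q"
      using O1(1) O2(1) assms(4,5)
      by (auto simp: outer_inverse_def P_def Q_def intro: Vector_Spaces.linear_compose)
  qed (simp_all add: P_def Q_def e)
  have I: "coperp B1 = range P"
  proof -
    have "range G1 = range P" unfolding P_def using e(1) by (auto simp: image_iff) metis
    then show ?thesis using O1(2) by simp
  qed
  \<comment> \<open>Orthogonal closedness recovers \<open>B1\<close> from
    \<open>coperp B1\<close>.\<close>
  have B1: "B1 = perp sV (range P)"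
    using assms(7) I by (simp add: orthogonally_closed_def)
  have C2': "C2 = perp sV (range Q)"
    using C2 unfolding O2(2)[symmetric] by (simp add: Q_def image_image)
  have K: "K1 = {v. P v = 0}"
    using K1 O1(3) by (auto simp: P_def)
  \<comment> \<open>If \<open>T2 (G2 v) = 0\<close>, applying \<open>G2\<close> gives
    \<open>G2 v = 0\<close>.\<close>
  have E: "E2 = {v. Q v = 0}"
    using O2(3) e(2) by (auto simp: Q_def) (metis G2.zero)
  have i: "outer_inverse sU sW (T1 \<circ> T2) (G2 \<circ> G1) \<longleftrightarrow> PQ.P_preserves"
    using outer_inverse_comp_iff[OF O1(1) O2(1)] PQ.idempotent_iff
    by (simp add: P_def Q_def)
  \<comment> \<open>The sum in (iv) is always direct: \<open>P\<close> fixes the vectors of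
    \<open>coperp B1\<close> and kills those of \<open>K1\<close>.\<close>
  have "K1 \<inter> (E2 \<inter> coperp B1) = {0}"
    unfolding I K E by (auto simp: PQ.mem_I)
  moreover have "coperp (B1 \<inter> C2) = range P + range Q" "coperp (B1 \<inter> perp sV E2) = range P + E2"
    unfolding B1 C2' E by (simp_all add: PQ.coperp_perp_Int)
  ultimately show ?thesis
    unfolding i using PQ.P_preserves_iff_perp_subset PQ.P_preserves_iff_I_subset
      PQ.I_subset_iff_perp PQ.P_preserves_iff_E_subset PQ.P_preserves_iff_K_subset
    by (simp add: I flip: B1 C2' K E)
qed

end
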